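(* Let $n,m\geq 1$ be integers, let $A\subset B\subset\mathbb{R}^n$ and let $u\colon A\to\mathbb{R}^m$, $v\colon B\to\mathbb{R}^m$ be $1$-Lipschitz maps. Let $\delta\geq 0$ and assume that $\lVert u(x)-v(x)\rVert\leq \delta$ for all $x\in A$. Then there exists a $1$-Lipschitz map $\tilde{u}\colon B\to\mathbb{R}^m$ such that $\tilde{u}(x)=u(x)$ for all $x\in A$ and $$\lVert v(x)-\tilde{u}(x)\rVert\leq \sqrt{\delta^2+2\delta\, d_v(A,B)}\quad\text{for all }x\in B.$$
   Context: Euclidean spaces carry the Euclidean norm; a map $f$ on a set $S\subset\mathbb{R}^n$ is $1$-Lipschitz if $\lVert f(x)-f(y)\rVert\leq\lVert x-y\rVert$ for all $x,y\in S$. For $A\subset B$ and $v\colon B\to\mathbb{R}^m$, $d_v(A,B)=\sup\{\lVert v(x)-v(y)\rVert\mid x\in A,\ y\in B\}\in[0,\infty]$ (with $\sup\emptyset=0$). Convention: $0\cdot\infty=0$ and $\sqrt{\infty}=\infty$. *)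

theory Defs
  imports "HOL-Analysis.Analysis"
begin

text \<open>
  The quantity \<open>d\<^sub>v(A,B)\<close> may be infinite, so it takes values in \<^typ>\<open>ennreal\<close>. There the
  conventions \<open>Sup {} = 0\<close> and \<open>0 * \<infinity> = 0\<close> hold, unlike \<open>Sup {} = -\<infinity>\<close> in \<^typ>\<open>ereal\<close>.
\<close>

definition sup_dist :: "('a \<Rightarrow> 'b::real_normed_vector) \<Rightarrow> 'a set \<Rightarrow> 'a set \<Rightarrow> ennreal" where
  "sup_dist v A B = Sup {ennreal (norm (v x - v y)) | x y. x \<in> A \<and> y \<in> B}"

definition ennreal_sqrt :: "ennreal \<Rightarrow> ennreal" where
  "ennreal_sqrt t = (if t = \<infinity> then \<infinity> else ennreal (sqrt (enn2real t)))"

end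

theory Submission
  imports Defs
begin

text \<open>
  The map \<open>(x, 0) \<mapsto> u x\<close> on \<open>A \<times> {0}\<close>, \<open>(x, r) \<mapsto> v x\<close> on \<open>B \<times> {r}\<close> with
  \<open>r\<^sup>2 = \<delta>\<^sup>2 + 2 \<delta> d\<^sub>v(A,B)\<close> is 1-Lipschitz for the Euclidean metric of the product with \<open>\<real>\<close>,
  since \<open>(\<delta> + \<parallel>v x - v y\<parallel>)\<^sup>2 \<le> r\<^sup>2 + \<parallel>x - y\<parallel>\<^sup>2\<close>. Extend it by Kirszbraun's theorem and
  restrict the extension to \<open>B \<times> {0}\<close>: points \<open>(x, 0)\<close> and \<open>(x, r)\<close> have distance \<open>r\<close>.
\<close>

section \<open>Kirszbraun's theorem\<close>

text \<open>Expand each square; the weights sum to 1, so both diagonal double sums collapse. The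
  left side is unchanged by translating \<open>z\<close>, which allows two different choices of
  origin.\<close>

lemma sum_weighted_norm_diff_squared:
  fixes z :: "'i \<Rightarrow> 'a::real_inner"
  assumes "sum c I = 1"
  shows "(\<Sum>i\<in>I. \<Sum>j\<in>I. c i * c j * (norm (z i - z j))\<^sup>2) =
         2 * (\<Sum>i\<in>I. c i * (norm (z i))\<^sup>2) - 2 * (norm (\<Sum>i\<in>I. c i *\<^sub>R z i))\<^sup>2"
proof -
  let ?N = "\<Sum>i\<in>I. c i * (norm (z i))\<^sup>2"
  have expand: "c i * c j * (norm (z i - z j))\<^sup>2 =
      c j * (c i * (norm (z i))\<^sup>2) + c i * (c j * (norm (z j))\<^sup>2)
        - 2 * ((c i *\<^sub>R z i) \<bullet> (c j *\<^sub>R z j))" for i j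
    by (simp add: power2_norm_eq_inner algebra_simps inner_commute)
  have "(\<Sum>i\<in>I. \<Sum>j\<in>I. c j * (c i * (norm (z i))\<^sup>2)) = ?N"
    by (simp add: assms flip: sum_distrib_right)
  moreover have "(\<Sum>i\<in>I. \<Sum>j\<in>I. c i * (c j * (norm (z j))\<^sup>2)) = ?N"
    by (simp add: assms flip: sum_distrib_left sum_distrib_right)
  moreover have "(\<Sum>i\<in>I. \<Sum>j\<in>I. 2 * ((c i *\<^sub>R z i) \<bullet> (c j *\<^sub>R z j))) =
      2 * (norm (\<Sum>i\<in>I. c i *\<^sub>R z i))\<^sup>2"
    unfolding power2_norm_eq_inner inner_sum_left inner_sum_right sum_distrib_left by (rule sum.swap)
  ultimately show ?thesis
    unfolding expand sum.distrib sum_subtractf by linarith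
qed

lemma continuous_on_Max_image:
  fixes f :: "'i \<Rightarrow> 'a::topological_space \<Rightarrow> 'b::linorder_topology"
  assumes "finite I" "I \<noteq> {}" "\<And>i. i \<in> I \<Longrightarrow> continuous_on S (f i)"
  shows "continuous_on S (\<lambda>x. Max ((\<lambda>i. f i x) ` I))"
  using assms by (induction I rule: finite_ne_induct) (auto intro!: continuous_on_max)

section \<open>One-point extension of short maps\<close>

text \<open>A partial 1-Lipschitz map is encoded by its graph, so that extension is inclusion.
  Single-valuedness is built in: equal first components force equal second ones.\<close>

definition short_graph :: "('a::metric_space \<times> 'b::metric_space) set \<Rightarrow> bool" where
  "short_graph G \<longleftrightarrow> (\<forall>p\<in>G. \<forall>q\<in>G. dist (snd p) (snd q) \<le> dist (fst p) (fst q))"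

lemma short_graph_subset: "short_graph G \<Longrightarrow> H \<subseteq> G \<Longrightarrow> short_graph H"
  unfolding short_graph_def by blast

text \<open>Minimise the worst excess \<open>F\<close> over the hull of the values. The minimiser is
  a convex combination of values with maximal excess, and averaging over these gives
  \<open>F y \<le> 0\<close>.\<close>

lemma short_graph_extend_finite:
  fixes G :: "('a::real_inner \<times> 'b::euclidean_space) set"
  assumes "finite G" and G: "short_graph G"
  shows "\<exists>y. \<forall>p\<in>G. dist (snd p) y \<le> dist (fst p) x"
proof (cases "G = {}")
  case False
  \<comment> \<open>\<open>f p y \<le> 0\<close> is the desired inequality, squared. Squares make
    \<open>f p\<close> quadratic in \<open>y\<close> and suit the weighted identity.\<close>
  define f where "f p y = (norm (snd p - y))\<^sup>2 - (norm (fst p - x))\<^sup>2" for p and y :: 'b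
  define F where "F y = Max ((\<lambda>p. f p y) ` G)" for y
  let ?C = "convex hull (snd ` G)"
  have cont: "continuous_on S (f p)" for p S
    unfolding f_def by (intro continuous_intros)
  have "continuous_on ?C F"
    unfolding F_def by (intro continuous_on_Max_image \<open>finite G\<close> False cont)
  moreover have "compact ?C"
    using \<open>finite G\<close> by (intro finite_imp_compact_convex_hull) auto
  ultimately obtain y where y: "y \<in> ?C" and ymin: "\<And>z. z \<in> ?C \<Longrightarrow> F y \<le> F z"
    using continuous_attains_inf[of ?C F] False by auto
  have f_le: "f p z \<le> F z" if "p \<in> G" for p z
    unfolding F_def using \<open>finite G\<close> that by simp
  define J where "J = {p \<in> G. f p y = F y}"
  let ?K = "convex hull (snd ` J)"
  have "finite J" "J \<subseteq> G"
    using \<open>finite G\<close> by (auto simp: J_def)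
  have "F y \<in> (\<lambda>p. f p y) ` G"
    unfolding F_def using \<open>finite G\<close> False by (intro Max_in) auto
  then obtain p where "p \<in> G" "F y = f p y"
    by (rule imageE)
  then have "p \<in> J"
    by (simp add: J_def)
  then have "J \<noteq> {}"
    by blast
  have "compact ?K"
    using \<open>finite J\<close> by (intro finite_imp_compact_convex_hull) auto
  have "y \<in> ?K"
  \<comment> \<open>Otherwise moving \<open>y\<close> towards its projection onto \<open>?K\<close> decreases all active \<open>f p\<close>.\<close>
  proof (rule ccontr)
    assume "y \<notin> ?K"
    define d where "d = closest_point ?K y - y"
    have K: "closed ?K" "?K \<noteq> {}"
      using \<open>compact ?K\<close> \<open>J \<noteq> {}\<close> by (auto intro: compact_imp_closed)
    have proj: "closest_point ?K y \<in> ?K"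
      using K by (rule closest_point_in_set)
    then have "d \<noteq> 0"
      using \<open>y \<notin> ?K\<close> by (auto simp: d_def)
    have active: "f p (y + e *\<^sub>R d) < F y" if "p \<in> J" "0 < e" "e < 1" for p e
    proof -
      have "snd p \<in> ?K"
        using \<open>p \<in> J\<close> by (simp add: hull_inc)
      \<comment> \<open>The angle at the projection is not acute. Hence the linear term below is at
        most \<open>- 2 * e * (d \<bullet> d)\<close>, which outweighs the quadratic term for
        \<open>e < 1\<close>.\<close>
      then have "(y - closest_point ?K y) \<bullet> (snd p - closest_point ?K y) \<le> 0"
        by (intro closest_point_dot K(1)) auto
      then have "d \<bullet> d \<le> d \<bullet> (snd p - y)"
        by (simp add: d_def algebra_simps inner_commute)
      moreover have "f p (y + e *\<^sub>R d) = f p y - 2 * e * (d \<bullet> (snd p - y)) + e * e * (d \<bullet> d)"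
        by (simp add: f_def power2_norm_eq_inner algebra_simps inner_commute)
      moreover have "e * e * (d \<bullet> d) < e * (d \<bullet> d)"
        using that \<open>d \<noteq> 0\<close> by simp
      moreover have "0 < e * (d \<bullet> d)"
        using that \<open>d \<noteq> 0\<close> by simp
      ultimately have "f p (y + e *\<^sub>R d) < f p y"
        using mult_left_mono[of "d \<bullet> d" "d \<bullet> (snd p - y)" e] that by (simp add: mult.assoc)
      then show ?thesis
        using \<open>p \<in> J\<close> by (simp add: J_def)
    qed
    have small: "\<forall>\<^sub>F e in at_right (0::real). 0 < e \<and> e < 1"
      by (simp add: eventually_at_right_field) (use zero_less_one in blast)
    \<comment> \<open>Active points allow every \<open>e\<close> in (0,1); inactive ones stay
      strictly below \<open>F y\<close> for small \<open>e\<close> by continuity. Finiteness of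
      \<open>G\<close> then yields a common \<open>e\<close>.\<close>
    have "\<forall>\<^sub>F e in at_right 0. f p (y + e *\<^sub>R d) < F y" if "p \<in> G" for p
    proof (cases "p \<in> J")
      case True
      with small show ?thesis
        by (auto intro: active elim: eventually_mono)
    next
      case False
      then have "f p y < F y"
        using f_le[OF that, of y] that by (simp add: J_def)
      moreover have "((\<lambda>e. f p (y + e *\<^sub>R d)) \<longlongrightarrow> f p (y + 0 *\<^sub>R d)) (at_right 0)"
        unfolding f_def by (intro tendsto_intros)
      ultimately show ?thesis
        by (intro order_tendstoD(2)[where a = "F y"]) simp_all
    qed
    then have "\<forall>\<^sub>F e in at_right 0. \<forall>p\<in>G. f p (y + e *\<^sub>R d) < F y"
      using \<open>finite G\<close> by (simp add: eventually_ball_finite)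
    with small have "\<forall>\<^sub>F e in at_right (0::real).
        0 < e \<and> e < 1 \<and> (\<forall>p\<in>G. f p (y + e *\<^sub>R d) < F y)"
      by eventually_elim simp
    then obtain e where e: "0 < e" "e < 1" "\<And>p. p \<in> G \<Longrightarrow> f p (y + e *\<^sub>R d) < F y"
      using eventually_happens'[OF trivial_limit_at_right_real] by blast
    then have "F (y + e *\<^sub>R d) < F y"
      unfolding F_def[of "y + e *\<^sub>R d"] using \<open>finite G\<close> \<open>G \<noteq> {}\<close> by simp
    \<comment> \<open>The moved point is
      \<open>(1 - e) *\<^sub>R y + e *\<^sub>R closest_point ?K y\<close>, so it stays in
      \<open>?C\<close>, where \<open>y\<close> is minimal.\<close>
    moreover have "closest_point ?K y \<in> ?C"
      using proj hull_mono[OF image_mono[OF \<open>J \<subseteq> G\<close>], of convex snd] by blast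
    then have "y + e *\<^sub>R d \<in> ?C"
      using convexD_alt[OF convex_convex_hull y, of "closest_point ?K y" e] e(1,2)
      by (simp add: d_def algebra_simps)
    ultimately show False
      using ymin by fastforce
  qed
  then obtain c where c: "\<And>t. t \<in> snd ` J \<Longrightarrow> 0 \<le> c t" "sum c (snd ` J) = 1"
      and cy: "(\<Sum>t\<in>snd ` J. c t *\<^sub>R t) = y"
    using convex_hull_finite[of "snd ` J"] \<open>finite J\<close> by auto
  \<comment> \<open>The weights are indexed by values, and several active points may share one;
    \<open>h\<close> picks one source for each value.\<close>
  define h where "h t = (SOME s. (s, t) \<in> J)" for t
  have h: "(h t, t) \<in> J" if "t \<in> snd ` J" for t
  proof -
    have "\<exists>s. (s, t) \<in> J"
      using that by auto
    then show ?thesis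
      unfolding h_def by (rule someI_ex)
  qed
  let ?T = "snd ` J"
  have bary: "(\<Sum>t\<in>?T. c t *\<^sub>R (t - y)) = 0"
    using c(2) cy by (simp add: scaleR_right_diff_distrib sum_subtractf flip: scaleR_sum_left)
  \<comment> \<open>The weighted identity is used twice: centred at \<open>y\<close> the mean
    vanishes, giving equality; centred at \<open>x\<close> the mean term is dropped, giving an upper
    bound. Shortness compares the double sums in between.\<close>
  have "2 * (\<Sum>t\<in>?T. c t * (norm (t - y))\<^sup>2)
      = (\<Sum>s\<in>?T. \<Sum>t\<in>?T. c s * c t * (norm (s - t))\<^sup>2)"
    using sum_weighted_norm_diff_squared[OF c(2), of "\<lambda>t. t - y"] bary by simp
  also have "\<dots> \<le> (\<Sum>s\<in>?T. \<Sum>t\<in>?T. c s * c t * (norm (h s - h t))\<^sup>2)"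
  proof (intro sum_mono mult_left_mono power_mono)
    fix s t assume "s \<in> ?T" "t \<in> ?T"
    then have "(h s, s) \<in> G" "(h t, t) \<in> G"
      using h \<open>J \<subseteq> G\<close> by blast+
    then have "dist (snd (h s, s)) (snd (h t, t)) \<le> dist (fst (h s, s)) (fst (h t, t))"
      using G unfolding short_graph_def by blast
    then show "norm (s - t) \<le> norm (h s - h t)"
      by (simp add: dist_norm)
  qed (simp_all add: c(1))
  also have "\<dots> \<le> 2 * (\<Sum>t\<in>?T. c t * (norm (h t - x))\<^sup>2)" (is "_ \<le> 2 * ?X")
    using sum_weighted_norm_diff_squared[OF c(2), of "\<lambda>t. h t - x"] by simp
  finally have "(\<Sum>t\<in>?T. c t * (norm (t - y))\<^sup>2) \<le> ?X"
    by linarith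
  \<comment> \<open>Each \<open>(h t, t)\<close> is active, so its excess is exactly
    \<open>F y\<close>; as the weights sum to 1, the comparison leaves
    \<open>F y \<le> 0\<close>.\<close>
  also have "?X = (\<Sum>t\<in>?T. c t * (norm (t - y))\<^sup>2 - c t * F y)"
  proof (rule sum.cong)
    fix t assume "t \<in> ?T"
    then have F: "F y = (norm (t - y))\<^sup>2 - (norm (h t - x))\<^sup>2"
      using h[of t] by (simp add: J_def f_def)
    show "c t * (norm (h t - x))\<^sup>2 = c t * (norm (t - y))\<^sup>2 - c t * F y"
      unfolding F by (simp add: right_diff_distrib)
  qed simp
  also have "\<dots> = (\<Sum>t\<in>?T. c t * (norm (t - y))\<^sup>2) - F y"
    unfolding sum_subtractf by (simp add: c(2) flip: sum_distrib_right)
  finally have "F y \<le> 0"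
    by linarith
  have "dist (snd p) y \<le> dist (fst p) x" if "p \<in> G" for p
  proof -
    have "(norm (snd p - y))\<^sup>2 \<le> (norm (fst p - x))\<^sup>2"
      using f_le[OF that, of y] \<open>F y \<le> 0\<close> unfolding f_def by linarith
    then show ?thesis
      unfolding dist_norm by (rule power2_le_imp_le) simp
  qed
  then show ?thesis
    by blast
qed simp

text \<open>The admissible \<open>y\<close> form an intersection of closed balls, compact in finite
  dimension. Finite subfamilies meet by the finite case, so all of them meet.\<close>

lemma short_graph_extend:
  fixes G :: "('a::real_inner \<times> 'b::euclidean_space) set"
  assumes G: "short_graph G"
  shows "\<exists>y. short_graph (insert (x, y) G)"
proof (cases "G = {}")
  case False
  then obtain q where "q \<in> G"
    by blast
  let ?B = "\<lambda>p. cball (snd p) (dist (fst p) x)"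
  \<comment> \<open>The ball of \<open>q\<close> is the compact set for the finite intersection
    property, hence \<open>q\<close> joins every finite subfamily.\<close>
  have "?B q \<inter> (\<Inter>p\<in>G. ?B p) \<noteq> {}"
  proof (rule compact_imp_fip_image)
    fix H assume "finite H" "H \<subseteq> G"
    then obtain y where "\<forall>p\<in>insert q H. dist (snd p) y \<le> dist (fst p) x"
      using short_graph_extend_finite[of "insert q H" x] \<open>q \<in> G\<close> short_graph_subset[OF G] by auto
    then show "?B q \<inter> (\<Inter>p\<in>H. ?B p) \<noteq> {}"
      by (intro ex_in_conv[THEN iffD1] exI[of _ y]) simp
  qed auto
  then obtain y where "\<forall>p\<in>G. dist (snd p) y \<le> dist (fst p) x"
    by auto
  with G show ?thesis
    unfolding short_graph_def by (auto simp: dist_commute intro!: exI[of _ y])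
qed (simp add: short_graph_def)

text \<open>By Zorn's lemma there is a maximal short graph above that of \<open>f\<close>; one-point
  extension forces it to be defined everywhere.\<close>

theorem Kirszbraun:
  fixes f :: "'a::real_inner \<Rightarrow> 'b::euclidean_space"
  assumes f: "1-lipschitz_on S f"
  obtains g where "1-lipschitz_on UNIV g" "\<And>x. x \<in> S \<Longrightarrow> g x = f x"
proof -
  let ?G = "(\<lambda>x. (x, f x)) ` S"
  let ?\<A> = "{G. short_graph G \<and> ?G \<subseteq> G}"
  have "\<exists>M\<in>?\<A>. \<forall>X\<in>?\<A>. M \<subseteq> X \<longrightarrow> X = M"
  proof (rule subset_Zorn_nonempty)
    have "short_graph ?G"
      using lipschitz_onD[OF f] by (auto simp: short_graph_def)
    then show "?\<A> \<noteq> {}"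
      by blast
  next
    fix \<C> assume "\<C> \<noteq> {}" and chain: "subset.chain ?\<A> \<C>"
    have "short_graph (\<Union>\<C>)"
      unfolding short_graph_def
    proof (intro ballI)
      fix p q assume "p \<in> \<Union>\<C>" "q \<in> \<Union>\<C>"
      then obtain X where "X \<in> \<C>" "p \<in> X" "q \<in> X"
        using chain by (blast dest: subset.chain_total)
      then show "dist (snd p) (snd q) \<le> dist (fst p) (fst q)"
        using chain unfolding subset.chain_def short_graph_def by blast
    qed
    moreover have "?G \<subseteq> \<Union>\<C>"
      using chain \<open>\<C> \<noteq> {}\<close> unfolding subset.chain_def by blast
    ultimately show "\<Union>\<C> \<in> ?\<A>"
      by simp
  qed
  then obtain M where M: "short_graph M" "?G \<subseteq> M"
      and max: "\<And>X. short_graph X \<Longrightarrow> ?G \<subseteq> X \<Longrightarrow> M \<subseteq> X \<Longrightarrow> X = M"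
    by auto
  have "\<exists>y. (x, y) \<in> M" for x
  proof -
    obtain y where "short_graph (insert (x, y) M)"
      using short_graph_extend[OF M(1)] by blast
    then have "insert (x, y) M = M"
      using M(2) by (intro max) auto
    then show ?thesis
      by blast
  qed
  then obtain g where g: "\<And>x. (x, g x) \<in> M"
    by metis
  \<comment> \<open>With \<open>x = x'\<close> this makes \<open>M\<close> single-valued, so
    \<open>g\<close> agrees with \<open>f\<close> on \<open>S\<close>.\<close>
  have short: "dist y y' \<le> dist x x'" if "(x, y) \<in> M" "(x', y') \<in> M" for x y x' y'
    using M(1) that unfolding short_graph_def by fastforce
  show ?thesis
  proof
    show "1-lipschitz_on UNIV g"
      by (rule lipschitz_onI) (auto intro: short g)
    show "g x = f x" if "x \<in> S" for x
    proof -
      have "(x, f x) \<in> M"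
        using M(2) that by blast
      from short[OF g[of x] this] show ?thesis
        by simp
    qed
  qed
qed

section \<open>Extension close to a given map\<close>

text \<open>This is the case of a finite bound \<open>d\<close>, stated in real arithmetic.\<close>

lemma lipschitz_extension_close:
  fixes u v :: "'a::real_inner \<Rightarrow> 'b::euclidean_space"
  assumes "A \<subseteq> B" and u: "1-lipschitz_on A u" and v: "1-lipschitz_on B v"
    and "0 \<le> \<delta>" and uv: "\<And>x. x \<in> A \<Longrightarrow> norm (u x - v x) \<le> \<delta>"
    and "0 \<le> d" and d: "\<And>x y. x \<in> A \<Longrightarrow> y \<in> B \<Longrightarrow> norm (v x - v y) \<le> d"
  obtains w where "1-lipschitz_on B w" "\<And>x. x \<in> A \<Longrightarrow> w x = u x"
    "\<And>x. x \<in> B \<Longrightarrow> norm (v x - w x) \<le> sqrt (\<delta>\<^sup>2 + 2 * \<delta> * d)"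
proof (cases "\<delta> = 0")
  \<comment> \<open>Here the two slices would coincide, but \<open>u\<close> and \<open>v\<close>
    agree on \<open>A\<close>, so \<open>v\<close> itself serves.\<close>
  case True
  show ?thesis
    by (rule that[of v]) (use v uv True in auto)
next
  case False
  define r where "r = sqrt (\<delta>\<^sup>2 + 2 * \<delta> * d)"
  have "0 < r"
    using \<open>0 \<le> \<delta>\<close> \<open>0 \<le> d\<close> False by (simp add: r_def add_pos_nonneg)
  have r2: "r\<^sup>2 = \<delta>\<^sup>2 + 2 * \<delta> * d"
    using \<open>0 \<le> \<delta>\<close> \<open>0 \<le> d\<close> by (simp add: r_def)
  \<comment> \<open>Since \<open>0 < r\<close>, the second coordinate tells the slices
    apart.\<close>
  define f where "f p = (if snd p = (0::real) then u (fst p) else v (fst p))" for p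
  let ?S = "A \<times> {0} \<union> B \<times> {r}"
  have cross: "dist (u x) (v y) \<le> dist (x, 0) (y, r)" if "x \<in> A" "y \<in> B" for x y
  proof -
    let ?t = "dist (v x) (v y)"
    have "dist (u x) (v y) \<le> \<delta> + ?t"
      using uv[OF that(1)] dist_triangle[of "u x" "v y" "v x"] by (simp add: dist_norm)
    then have "(dist (u x) (v y))\<^sup>2 \<le> (\<delta> + ?t)\<^sup>2"
      by (simp add: power_mono)
    also have "\<dots> = \<delta>\<^sup>2 + 2 * \<delta> * ?t + ?t\<^sup>2"
      by (simp add: power2_sum)
    also have "\<dots> \<le> r\<^sup>2 + (dist x y)\<^sup>2"
    proof -
      have "2 * \<delta> * ?t \<le> 2 * \<delta> * d"
        using d[OF that] \<open>0 \<le> \<delta>\<close> by (simp add: dist_norm mult_left_mono)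
      moreover have "?t\<^sup>2 \<le> (dist x y)\<^sup>2"
        using lipschitz_onD[OF v, of x y] that \<open>A \<subseteq> B\<close> by (auto intro: power_mono)
      ultimately show ?thesis
        unfolding r2 by linarith
    qed
    finally show ?thesis
      by (simp add: dist_Pair_Pair dist_real_def add.commute real_le_rsqrt)
  qed
  have "1-lipschitz_on ?S f"
  proof (rule lipschitz_onI)
    fix p q assume "p \<in> ?S" "q \<in> ?S"
    then show "dist (f p) (f q) \<le> 1 * dist p q"
      using \<open>0 < r\<close> lipschitz_onD[OF u] lipschitz_onD[OF v] cross
      by (auto simp: f_def dist_Pair_Pair) (metis dist_commute)+
  qed simp
  then obtain g where g: "1-lipschitz_on UNIV g" "\<And>p. p \<in> ?S \<Longrightarrow> g p = f p"
    using Kirszbraun by blast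
  show ?thesis
  proof
    show "1-lipschitz_on B (\<lambda>x. g (x, 0))"
    proof (rule lipschitz_onI)
      show "dist (g (x, 0)) (g (y, 0)) \<le> 1 * dist x y" for x y
        using lipschitz_onD[OF g(1), of "(x, 0)" "(y, 0)"] by (simp add: dist_Pair_Pair)
    qed simp
    show "g (x, 0) = u x" if "x \<in> A" for x
      using g(2)[of "(x, 0)"] that by (simp add: f_def)
    show "norm (v x - g (x, 0)) \<le> sqrt (\<delta>\<^sup>2 + 2 * \<delta> * d)" if "x \<in> B" for x
      using lipschitz_onD[OF g(1), of "(x, r)" "(x, 0)"] g(2)[of "(x, r)"] that \<open>0 < r\<close>
      by (simp add: f_def dist_Pair_Pair dist_norm flip: r_def)
  qed
qed

theorem proposition2p1:
  fixes A B :: "(real ^ 'n) set"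
    and u v :: "real ^ 'n \<Rightarrow> real ^ 'm"
    and \<delta> :: real
  assumes "A \<subseteq> B"
    and "1-lipschitz_on A u"
    and "1-lipschitz_on B v"
    and "\<delta> \<ge> 0"
    and "\<And>x. x \<in> A \<Longrightarrow> norm (u x - v x) \<le> \<delta>"
  shows "\<exists>u' :: real ^ 'n \<Rightarrow> real ^ 'm.
           1-lipschitz_on B u' \<and>
           (\<forall>x\<in>A. u' x = u x) \<and>
           (\<forall>x\<in>B. ennreal (norm (v x - u' x))
                    \<le> ennreal_sqrt (ennreal (\<delta>\<^sup>2) + 2 * ennreal \<delta> * sup_dist v A B))"
proof (cases "sup_dist v A B = \<infinity>")
  case True
  show ?thesis
  \<comment> \<open>For \<delta> = 0 the convention \<open>0 * \<infinity> = 0\<close> makes the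
    bound 0, met by \<open>v\<close>; otherwise the bound is infinite and any 1-Lipschitz extension
    of \<open>u\<close> works.\<close>
  proof (cases "\<delta> = 0")
    case True
    then show ?thesis
      using assms by (intro exI[of _ v]) auto
  next
    case False
    then have "2 * ennreal \<delta> * sup_dist v A B = \<infinity>"
      using True \<open>\<delta> \<ge> 0\<close> by (simp add: ennreal_mult_top)
    then have top: "ennreal_sqrt (ennreal (\<delta>\<^sup>2) + 2 * ennreal \<delta> * sup_dist v A B) = \<infinity>"
      by (simp add: ennreal_sqrt_def)
    obtain g where "1-lipschitz_on UNIV g" "\<And>x. x \<in> A \<Longrightarrow> g x = u x"
      using Kirszbraun[OF assms(2)] by metis
    then show ?thesis
      unfolding top by (intro exI[of _ g]) (auto intro: lipschitz_on_subset)
  qed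
next
  case False
  define d where "d = enn2real (sup_dist v A B)"
  have "0 \<le> d" and sup: "sup_dist v A B = ennreal d"
    using False by (simp_all add: d_def less_top)
  have "norm (v x - v y) \<le> d" if "x \<in> A" "y \<in> B" for x y
  proof -
    have "ennreal (norm (v x - v y)) \<le> sup_dist v A B"
      unfolding sup_dist_def using that by (intro Sup_upper) blast
    then show ?thesis
      using \<open>0 \<le> d\<close> by (simp add: sup)
  qed
  then obtain w where w: "1-lipschitz_on B w" "\<And>x. x \<in> A \<Longrightarrow> w x = u x"
      "\<And>x. x \<in> B \<Longrightarrow> norm (v x - w x) \<le> sqrt (\<delta>\<^sup>2 + 2 * \<delta> * d)"
    using lipschitz_extension_close[OF assms \<open>0 \<le> d\<close>] by metis
  \<comment> \<open>All terms are finite and nonnegative, so the extended expression reduces to the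
    real one.\<close>
  have "ennreal (\<delta>\<^sup>2) + 2 * ennreal \<delta> * sup_dist v A B = ennreal (\<delta>\<^sup>2 + 2 * \<delta> * d)"
    using \<open>\<delta> \<ge> 0\<close> \<open>0 \<le> d\<close> by (simp add: sup ennreal_mult ennreal_plus)
  then have "ennreal_sqrt (ennreal (\<delta>\<^sup>2) + 2 * ennreal \<delta> * sup_dist v A B)
      = ennreal (sqrt (\<delta>\<^sup>2 + 2 * \<delta> * d))"
    using \<open>\<delta> \<ge> 0\<close> \<open>0 \<le> d\<close> by (simp add: ennreal_sqrt_def del: ennreal_plus)
  then show ?thesis
    using w by (intro exI[of _ w]) (auto intro: ennreal_leI)
qed

end
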